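(* Let $C\subseteq\mathbb{R}^n$ be a closed, convex set. Let $\langle c,x\rangle\le\delta$ be a valid inequality for $C\cap\mathbb{Z}^n$. If there exists a cutting plane proof of size $L$ and sparsity $s$ certifying the validity of this inequality, which is derived using general split disjunctions of sparsity $s$, then there exists a branch-and-bound proof of sparsity $s$ (based on split disjunctions) which proves the validity of $\langle c,x\rangle\le\delta$ and takes at most $O(L)$ iterations (i.e., has $O(L)$ nodes).
   Context: A split disjunction in $\mathbb{R}^n$ is $\{x:\langle\pi,x\rangle\le\pi_0\}\cup\{x:\langle\pi,x\rangle\ge\pi_0+1\}$ with $\pi\in\mathbb{Z}^n$, $\pi_0\in\mathbb{Z}$; it has sparsity $s$ if $\pi$ has at most $s$ non-zero entries. A cutting plane $\{x : \langle a,x\rangle\le\beta\}$ has sparsity $s$ if it can be represented by an inequality with at most $s$ non-zero coefficients. For a closed convex set $N$, a cutting plane for $N$ derived using a split disjunction $D$ is a halfspace $H$ with $N\cap D\subseteq H$. All cutting planes are assumed to be rational, i.e., describable with integer coefficients and integer right-hand side. It is also assumed that every convex optimization problem to be solved has an optimal solution or is infeasible. Proofs start from the root $C$. In a cutting plane proof, each non-leaf node $N$ has a single child $N\cap H$, where $H$ is a cutting plane derived for $N$ (so the tree is a path); the proof has sparsity $s$ if all its cutting planes do. In a branch-and-bound proof, each non-leaf node $N$ has children $Q_1\cap N,\ Q_2\cap N$ for some split disjunction $Q_1\cup Q_2$; the proof has sparsity $s$ if all its disjunctions do. In either case the finite tree proves the validity of $\langle c,x\rangle\le\delta$ if this inequality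 is valid for all leaves. It is not required that the disjunction or cut used at a node cut off an optimal solution of the relaxation at that node. The size of a proof is the total number of nodes. *)

theory Defs
  imports "HOL-Analysis.Analysis"
begin

text \<open>
  The space $R^n$ is the carrier of the library topology \<^const>\<open>Euclidean_space\<close> \<open>n\<close>: functions
  \<open>nat \<Rightarrow> real\<close> that vanish at every index \<open>i \<ge> n\<close>.  This, rather than a type-indexed
  \<open>real ^ 'n\<close>, lets the constant hidden in \<open>O(L)\<close> be chosen before the dimension.
  Coefficient vectors are arbitrary functions on \<open>nat\<close>, of which only the entries \<open>i < n\<close>
  are ever used.
\<close>

abbreviation Rn :: "nat \<Rightarrow> (nat \<Rightarrow> real) set" where
  "Rn n \<equiv> topspace (Euclidean_space n)"

definition Zn :: "nat \<Rightarrow> (nat \<Rightarrow> real) set" where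
  "Zn n = {x \<in> Rn n. \<forall>i<n. x i \<in> \<int>}"

definition dotn :: "nat \<Rightarrow> (nat \<Rightarrow> real) \<Rightarrow> (nat \<Rightarrow> real) \<Rightarrow> real" where
  "dotn n a x = (\<Sum>i<n. a i * x i)"

text \<open>\<open>nat \<Rightarrow> real\<close> is not an instance of \<^class>\<open>real_vector\<close>, so the defining formula of
  \<^const>\<open>convex\<close> is written out componentwise.\<close>

definition convex_fun :: "(nat \<Rightarrow> real) set \<Rightarrow> bool" where
  "convex_fun C \<longleftrightarrow>
     (\<forall>x\<in>C. \<forall>y\<in>C. \<forall>u\<ge>0. \<forall>v\<ge>0. u + v = 1 \<longrightarrow> (\<lambda>i. u * x i + v * y i) \<in> C)"

definition valid_ineq :: "nat \<Rightarrow> (nat \<Rightarrow> real) \<Rightarrow> real \<Rightarrow> (nat \<Rightarrow> real) set \<Rightarrow> bool" where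
  "valid_ineq n c \<delta> X \<longleftrightarrow> (\<forall>x\<in>X. dotn n c x \<le> \<delta>)"

definition sparse_vec :: "nat \<Rightarrow> nat \<Rightarrow> (nat \<Rightarrow> 'a::zero) \<Rightarrow> bool" where
  "sparse_vec n s a \<longleftrightarrow> card {i. i < n \<and> a i \<noteq> 0} \<le> s"


definition split_le :: "nat \<Rightarrow> (nat \<Rightarrow> int) \<Rightarrow> int \<Rightarrow> (nat \<Rightarrow> real) set" where
  "split_le n p p0 = {x \<in> Rn n. dotn n (\<lambda>i. of_int (p i)) x \<le> of_int p0}"

definition split_ge :: "nat \<Rightarrow> (nat \<Rightarrow> int) \<Rightarrow> int \<Rightarrow> (nat \<Rightarrow> real) set" where
  "split_ge n p p0 = {x \<in> Rn n. dotn n (\<lambda>i. of_int (p i)) x \<ge> of_int p0 + 1}"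


definition halfspace_le :: "nat \<Rightarrow> (nat \<Rightarrow> real) \<Rightarrow> real \<Rightarrow> (nat \<Rightarrow> real) set" where
  "halfspace_le n a b = {x \<in> Rn n. dotn n a x \<le> b}"

text \<open>A cut is a set.  Rationality and sparsity each ask for some representing inequality,
  not necessarily the same one.  The inequality with all coefficients \<open>0\<close> is allowed.\<close>

definition rational_cut :: "nat \<Rightarrow> (nat \<Rightarrow> real) set \<Rightarrow> bool" where
  "rational_cut n H \<longleftrightarrow>
     (\<exists>(a :: nat \<Rightarrow> int) (b :: int). H = halfspace_le n (\<lambda>i. of_int (a i)) (of_int b))"

definition sparse_cut :: "nat \<Rightarrow> nat \<Rightarrow> (nat \<Rightarrow> real) set \<Rightarrow> bool" where
  "sparse_cut n s H \<longleftrightarrow> (\<exists>a b. sparse_vec n s a \<and> H = halfspace_le n a b)"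


datatype proof_tree = Node (node_set: "(nat \<Rightarrow> real) set") (children: "proof_tree list")

fun num_nodes :: "proof_tree \<Rightarrow> nat" where
  "num_nodes (Node N ts) = 1 + sum_list (map num_nodes ts)"

fun leaf_sets :: "proof_tree \<Rightarrow> (nat \<Rightarrow> real) set set" where
  "leaf_sets (Node N ts) = (if ts = [] then {N} else (\<Union>t\<in>set ts. leaf_sets t))"

inductive cutting_plane_tree :: "nat \<Rightarrow> nat \<Rightarrow> proof_tree \<Rightarrow> bool" for n s where
  leaf: "cutting_plane_tree n s (Node N [])"
| cut: "\<lbrakk> sparse_vec n s p;
          N \<inter> (split_le n p p0 \<union> split_ge n p p0) \<subseteq> H;
          rational_cut n H; sparse_cut n s H;
          node_set t = N \<inter> H; cutting_plane_tree n s t \<rbrakk>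
        \<Longrightarrow> cutting_plane_tree n s (Node N [t])"

inductive branch_and_bound_tree :: "nat \<Rightarrow> nat \<Rightarrow> proof_tree \<Rightarrow> bool" for n s where
  leaf: "branch_and_bound_tree n s (Node N [])"
| branch: "\<lbrakk> sparse_vec n s p;
             node_set t1 = split_le n p p0 \<inter> N; branch_and_bound_tree n s t1;
             node_set t2 = split_ge n p p0 \<inter> N; branch_and_bound_tree n s t2 \<rbrakk>
           \<Longrightarrow> branch_and_bound_tree n s (Node N [t1, t2])"

definition tree_proves ::
    "nat \<Rightarrow> (nat \<Rightarrow> real) set \<Rightarrow> (nat \<Rightarrow> real) \<Rightarrow> real \<Rightarrow> proof_tree \<Rightarrow> bool" where
  "tree_proves n C c \<delta> T \<longleftrightarrow> node_set T = C \<and> (\<forall>N\<in>leaf_sets T. valid_ineq n c \<delta> N)"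

definition cutting_plane_proof ::
    "nat \<Rightarrow> nat \<Rightarrow> (nat \<Rightarrow> real) set \<Rightarrow> (nat \<Rightarrow> real) \<Rightarrow> real \<Rightarrow> proof_tree \<Rightarrow> bool" where
  "cutting_plane_proof n s C c \<delta> T \<longleftrightarrow> cutting_plane_tree n s T \<and> tree_proves n C c \<delta> T"

definition branch_and_bound_proof ::
    "nat \<Rightarrow> nat \<Rightarrow> (nat \<Rightarrow> real) set \<Rightarrow> (nat \<Rightarrow> real) \<Rightarrow> real \<Rightarrow> proof_tree \<Rightarrow> bool" where
  "branch_and_bound_proof n s C c \<delta> T \<longleftrightarrow> branch_and_bound_tree n s T \<and> tree_proves n C c \<delta> T"

end

theory Submission
  imports Defs
begin

text \<open>
  A rational cut \<open>H\<close> of sparsity \<open>s\<close> is one side of a split disjunction of sparsity \<open>s\<close>.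
  To simulate a cut at \<open>N\<close>, branch on that split.  One child is \<open>N \<inter> H\<close>; at the other one,
  branch on the disjunction from which \<open>H\<close> was derived.  Both grandchildren lie in \<open>H\<close> as
  well as in the side opposite to \<open>H\<close>, so they are empty.  Each cut thus costs three extra nodes.
\<close>

lemma dotn_fun_upd:
  assumes "i < n"
  shows "dotn n a (x(i := t)) = dotn n a x + a i * (t - x i)"
proof -
  have *: "dotn n a y = a i * y i + (\<Sum>j\<in>{..<n} - {i}. a j * y j)" for y
    unfolding dotn_def using assms by (subst sum.remove[of _ i]) auto
  have "(\<Sum>j\<in>{..<n} - {i}. a j * (x(i := t)) j) = (\<Sum>j\<in>{..<n} - {i}. a j * x j)"
    by (rule sum.cong) auto
  then show ?thesis
    unfolding *[of "x(i := t)"] *[of x] by (simp add: algebra_simps)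
qed

text \<open>If \<open>a' i = 0\<close>, moving a point along coordinate \<open>i\<close> never
  leaves the halfspace of \<open>a'\<close>, whereas \<open>a i \<noteq> 0\<close> lets such a move
  violate the inequality of \<open>a\<close>. Nonemptiness supplies the point to start from.\<close>

lemma halfspace_le_support_subset:
  assumes eq: "halfspace_le n a b = halfspace_le n a' b'"
    and ne: "halfspace_le n a b \<noteq> {}"
    and i: "i < n" and ai: "a i \<noteq> 0"
  shows "a' i \<noteq> 0"
proof
  assume a'i: "a' i = 0"
  obtain x where x: "x \<in> halfspace_le n a b"
    using ne by blast
  \<comment> \<open>Solves for the value of coordinate \<open>i\<close> at which the left-hand side
    becomes exactly \<open>b + 1\<close>.\<close>
  define t where "t = x i + (b + 1 - dotn n a x) / a i"
  have "x(i := t) \<in> halfspace_le n a' b'"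
    using x i a'i unfolding eq
    by (auto simp: halfspace_le_def dotn_fun_upd topspace_Euclidean_space)
  then have "dotn n a (x(i := t)) \<le> b"
    unfolding eq[symmetric] by (simp add: halfspace_le_def)
  moreover have "dotn n a (x(i := t)) = b + 1"
    using i ai by (simp add: dotn_fun_upd t_def)
  ultimately show False
    by simp
qed

text \<open>The integral and the sparse representation of \<open>H\<close> may differ. For nonempty
  \<open>H\<close> the support of the integral one is contained in that of the sparse one, so it is
  itself sparse.\<close>

lemma sparse_rational_cut_eq_split_le:
  assumes "rational_cut n H" and "sparse_cut n s H"
  obtains p p0 where "sparse_vec n s p" and "H = split_le n p p0"
proof (cases "H = {}")
  case True
  show ?thesis
  proof (rule that)
    show "sparse_vec n s (\<lambda>_. 0 :: int)"
      by (simp add: sparse_vec_def)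
    \<comment> \<open>The empty cut is 0 <= -1; the opposite side, 0 >= 0, is then the whole
      space.\<close>
    show "H = split_le n (\<lambda>_. 0) (- 1)"
      by (simp add: True split_le_def dotn_def)
  qed
next
  case False
  obtain p :: "nat \<Rightarrow> int" and p0 :: int
    where p: "H = halfspace_le n (\<lambda>i. of_int (p i)) (of_int p0)"
    using assms(1) unfolding rational_cut_def by blast
  obtain a b where a: "sparse_vec n s a" "H = halfspace_le n a b"
    using assms(2) unfolding sparse_cut_def by blast
  have "{i. i < n \<and> p i \<noteq> 0} \<subseteq> {i. i < n \<and> a i \<noteq> 0}"
    using halfspace_le_support_subset[of n "\<lambda>i. of_int (p i)" "of_int p0" a b] p a(2) False
    by auto
  then have "card {i. i < n \<and> p i \<noteq> 0} \<le> card {i. i < n \<and> a i \<noteq> 0}"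
    by (intro card_mono) auto
  then have "sparse_vec n s p"
    using a(1) by (simp add: sparse_vec_def)
  then show ?thesis
    using p by (intro that) (simp_all add: halfspace_le_def split_le_def)
qed

lemma split_le_disjoint_split_ge: "split_le n p p0 \<inter> split_ge n p p0 = {}"
  by (auto simp: split_le_def split_ge_def)

lemma branch_and_bound_simulates_cutting_planes:
  assumes "cutting_plane_tree n s T" and "\<forall>N\<in>leaf_sets T. valid_ineq n c \<delta> N"
  shows "\<exists>T'. branch_and_bound_proof n s (node_set T) c \<delta> T' \<and> num_nodes T' \<le> 4 * num_nodes T"
  using assms
proof (induction rule: cutting_plane_tree.induct)
  case (leaf N)
  then show ?case
    by (intro exI[of _ "Node N []"])
      (simp add: branch_and_bound_proof_def tree_proves_def branch_and_bound_tree.leaf)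
next
  case (cut q N q0 H t)
  obtain t' where t': "branch_and_bound_proof n s (N \<inter> H) c \<delta> t'"
    "num_nodes t' \<le> 4 * num_nodes t"
    using cut by auto
  obtain p p0 where p: "sparse_vec n s p" and H: "H = split_le n p p0"
    using cut.hyps sparse_rational_cut_eq_split_le by blast
  define R where "R = split_ge n p p0 \<inter> N"
  define r where "r = Node R [Node {} [], Node {} []]"
  \<comment> \<open>A point in either set would lie in \<open>N\<close> and in the disjunction of
    \<open>q\<close>, hence in \<open>H\<close>, but \<open>R\<close> lies on the side opposite to
    \<open>H\<close>.\<close>
  have empty: "split_le n q q0 \<inter> R = {}" "split_ge n q q0 \<inter> R = {}"
    using cut.hyps(2) split_le_disjoint_split_ge[of n p p0] unfolding R_def H by blast+
  have "branch_and_bound_tree n s r"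
    unfolding r_def
    by (rule branch_and_bound_tree.branch[OF cut.hyps(1), where ?p0.0 = q0])
      (simp_all add: empty branch_and_bound_tree.leaf)
  then have "branch_and_bound_tree n s (Node N [t', r])"
    using t'(1) H
    by (intro branch_and_bound_tree.branch[OF p])
      (auto simp: branch_and_bound_proof_def tree_proves_def r_def R_def)
  \<comment> \<open>The leaves below \<open>r\<close> are empty, so the inequality is vacuously
    valid there; all others are leaves of \<open>t'\<close>.\<close>
  then have "branch_and_bound_proof n s N c \<delta> (Node N [t', r])"
    using t'(1)
    by (auto simp: branch_and_bound_proof_def tree_proves_def r_def valid_ineq_def)
  \<comment> \<open>The root and the three nodes of \<open>r\<close> account for the 4 allotted to
    the node \<open>N\<close>.\<close>
  moreover have "num_nodes (Node N [t', r]) \<le> 4 * num_nodes (Node N [t])"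
    using t'(2) by (simp add: r_def)
  ultimately show ?case
    by auto
qed

theorem theorem1p9:
  shows "\<exists>K :: nat. \<forall>(n :: nat) (s :: nat) (L :: nat) (C :: (nat \<Rightarrow> real) set)
            (c :: nat \<Rightarrow> real) (\<delta> :: real).
     closedin (Euclidean_space n) C \<longrightarrow> convex_fun C \<longrightarrow>
     valid_ineq n c \<delta> (C \<inter> Zn n) \<longrightarrow>
     (\<exists>T. cutting_plane_proof n s C c \<delta> T \<and> num_nodes T = L) \<longrightarrow>
     (\<exists>T'. branch_and_bound_proof n s C c \<delta> T' \<and> num_nodes T' \<le> K * L)"
  using branch_and_bound_simulates_cutting_planes
  unfolding cutting_plane_proof_def tree_proves_def
  by (intro exI[of _ 4]) blast

end
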